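(* Let $0<\alpha<1$ be a constant and let $H(x)=-x\log_{2}x-(1-x)\log_{2}(1-x)$ for $0<x<1$ be the binary entropy function. Let $G$ be any undirected simple graph on $n$ vertices. Then the number of even induced subgraphs of $G$ whose order lies in the interval $[\alpha n/2,\alpha n]$ is at least $$2^{(1+o(1))\left(H(\frac{\alpha}{2})-\alpha\right)n},$$ where $o(1)$ denotes a quantity tending to $0$ as $n\to\infty$.
   Context: An induced subgraph $H$ of a graph $G$ is called even if every vertex of $H$ has even degree in $H$. Induced subgraphs are counted as vertex subsets $S\subseteq V(G)$ (i.e. $G[S]$ for distinct $S$ are counted as distinct). *)

theory Defs
  imports Complex_Main "Graph_Theory.Digraph_Component"
begin

definition binary_entropy :: "real \<Rightarrow> real" where
  "binary_entropy x = - x * log 2 x - (1 - x) * log 2 (1 - x)"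

text \<open>
  Finite undirected simple graphs are instances of the locale \<^locale>\<open>graph\<close>: finite, loop-free,
  symmetric digraphs without parallel arcs, so that each edge is a pair of opposite arcs. The
  degree of a vertex is therefore its \<^const>\<open>out_degree\<close>.
\<close>

definition even_graph :: "('a, 'b) pre_digraph \<Rightarrow> bool" where
  "even_graph H \<longleftrightarrow> (\<forall>v \<in> verts H. even (out_degree H v))"

definition even_induced_in_range :: "('a, 'b) pre_digraph \<Rightarrow> real \<Rightarrow> real \<Rightarrow> 'a set set" where
  "even_induced_in_range G a b =
     {S. S \<subseteq> verts G \<and> even_graph (G \<restriction> S) \<and> a \<le> real (card S) \<and> real (card S) \<le> b}"

end

theory Submission
  imports Defs "HOL-Real_Asymp.Real_Asymp"
begin

text \<open>
  By Gallai's theorem every finite graph splits into two even induced subgraphs, so a set of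
  about \<open>\<alpha> n\<close> vertices contains an even set of at least half its size. Double counting the pairs
  of a \<open>2j\<close>-set and an even subset of size at least \<open>j\<close> bounds the number of even sets from below
  by \<open>(n choose j) / (2j choose j) \<ge> (n choose j) / 4 ^ j\<close>, and \<open>j \<approx> \<alpha> n / 2\<close> gives the exponent.
  To hit the interval exactly, take \<open>j = \<lfloor>\<alpha> n / 2\<rfloor> + 1\<close> and find an even subset of order
  between \<open>j\<close> and \<open>2j - 2\<close> in each \<open>2j\<close>-set \<open>S\<close>: if some \<open>S - {v}\<close> is not even, Gallai's partition
  of it is nontrivial; otherwise \<open>S\<close> is complete or empty.
\<close>

section \<open>Gallai's partition theorem\<close>

text \<open>Adjacency is a bare relation rather than a digraph, so that the induction behind
  Gallai's theorem can pass to a modified adjacency on the same vertices.\<close>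

definition even_on :: "('a \<Rightarrow> 'a \<Rightarrow> bool) \<Rightarrow> 'a set \<Rightarrow> bool" where
  "even_on E A \<longleftrightarrow> (\<forall>v\<in>A. even (card {w \<in> A. E v w}))"

text \<open>Edges and non-edges among the neighbours of \<open>v\<close> are exchanged. The conjunct
  \<open>u \<noteq> w\<close> keeps the result loop-free.\<close>

definition local_complement :: "('a \<Rightarrow> 'a \<Rightarrow> bool) \<Rightarrow> 'a \<Rightarrow> 'a \<Rightarrow> 'a \<Rightarrow> bool" where
  "local_complement E v u w \<longleftrightarrow> u \<noteq> w \<and> (E u w \<noteq> (E v u \<and> E v w))"

lemma even_card_xor:
  assumes "finite A"
  shows "even (card {w \<in> A. P w \<noteq> Q w}) \<longleftrightarrow>
    (even (card {w \<in> A. P w}) \<longleftrightarrow> even (card {w \<in> A. Q w}))"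
proof -
  let ?P = "{w \<in> A. P w}" and ?Q = "{w \<in> A. Q w}"
  have "{w \<in> A. P w \<noteq> Q w} = (?P - ?Q) \<union> (?Q - ?P)" by auto
  then have "card {w \<in> A. P w \<noteq> Q w} = card (?P - ?Q) + card (?Q - ?P)"
    using assms card_Un_disjoint[of "?P - ?Q" "?Q - ?P"] by auto
  moreover have "card ?P = card (?P - ?Q) + card (?P \<inter> ?Q)"
    using assms card_Int_Diff[of ?P ?Q] by simp
  moreover have "card ?Q = card (?Q - ?P) + card (?P \<inter> ?Q)"
    using assms card_Int_Diff[of ?Q ?P] by (simp add: Int_commute)
  ultimately show ?thesis by auto
qed

text \<open>For a neighbour \<open>u\<close> of \<open>v\<close>, adjacency to \<open>w\<close> is
  xored with "\<open>w\<close> is a neighbour of \<open>v\<close> other than \<open>u\<close>". As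
  \<open>u\<close> is itself a neighbour of \<open>v\<close> in \<open>A\<close>, the xored set is
  one smaller than the neighbourhood of \<open>v\<close> in \<open>A\<close>, so the parity at
  \<open>u\<close> flips exactly when that neighbourhood is even.\<close>

lemma even_card_local_complement:
  assumes "finite A" "irreflp E" "u \<in> A"
  shows "even (card {w \<in> A. local_complement E v u w}) \<longleftrightarrow>
    (even (card {w \<in> A. E u w}) \<longleftrightarrow> \<not> E v u \<or> odd (card {w \<in> A. E v w}))"
proof (cases "E v u")
  case False
  then have "{w \<in> A. local_complement E v u w} = {w \<in> A. E u w}"
    using \<open>irreflp E\<close> by (auto simp: local_complement_def irreflp_def)
  with False show ?thesis by simp
next
  case True
  have "{w \<in> A. local_complement E v u w} = {w \<in> A. E u w \<noteq> (E v w \<and> w \<noteq> u)}"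
    using True \<open>irreflp E\<close> by (auto simp: local_complement_def irreflp_def)
  moreover have "{w \<in> A. E v w \<and> w \<noteq> u} = {w \<in> A. E v w} - {u}" by auto
  moreover have "card ({w \<in> A. E v w} - {u}) = card {w \<in> A. E v w} - 1"
    using True assms by simp
  moreover have "card {w \<in> A. E v w} > 0"
    using True assms by (auto simp: card_gt_0_iff)
  ultimately show ?thesis
    using True even_card_xor[OF \<open>finite A\<close>, of "E u" "\<lambda>w. E v w \<and> w \<noteq> u"] by simp
qed

text \<open>Local complementation preserves every degree parity inside such an
  \<open>A\<close>.\<close>

lemma even_on_if_odd_neighbours:
  assumes "finite A" "irreflp E" "even_on (local_complement E v) A" "odd (card {w \<in> A. E v w})"
  shows "even_on E A"
  using assms by (auto simp: even_on_def even_card_local_complement)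

text \<open>Here the complementation flips the parity of exactly the neighbours of \<open>v\<close>
  in \<open>A\<close>. Inserting \<open>v\<close> raises exactly these degrees by one and repairs
  them.\<close>

lemma even_on_insert_if_even_neighbours:
  assumes "finite A" "irreflp E" "symp E" "v \<notin> A"
    and "even_on (local_complement E v) A" "even (card {w \<in> A. E v w})"
  shows "even_on E (insert v A)"
  unfolding even_on_def
proof
  fix u assume u: "u \<in> insert v A"
  show "even (card {w \<in> insert v A. E u w})"
  proof (cases "u = v")
    case True
    then have "{w \<in> insert v A. E u w} = {w \<in> A. E v w}"
      using \<open>irreflp E\<close> by (auto simp: irreflp_def)
    then show ?thesis using assms by simp
  next
    case False
    then have "u \<in> A" using u by simp
    then have *: "even (card {w \<in> A. E u w}) \<longleftrightarrow> \<not> E v u"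
      using assms even_card_local_complement[of A E u v] by (auto simp: even_on_def)
    have "{w \<in> insert v A. E u w} = (if E v u then insert v {w \<in> A. E u w} else {w \<in> A. E u w})"
      using \<open>symp E\<close> by (auto dest: sympD)
    then show ?thesis using * assms by simp
  qed
qed

text \<open>Induction on \<open>S\<close> for all relations at once: a vertex \<open>v\<close> of
  odd degree is removed, the rest is split with respect to the local complement at \<open>v\<close>,
  and \<open>v\<close> is put back into the suitable part.\<close>

theorem even_partition:
  assumes "finite S" "irreflp E" "symp E"
  shows "\<exists>A B. A \<union> B = S \<and> A \<inter> B = {} \<and> even_on E A \<and> even_on E B"
  using assms
proof (induction S arbitrary: E rule: finite_psubset_induct)
  case (psubset S)
  show ?case
  proof (cases "even_on E S")
    case True
    then show ?thesis by (intro exI[of _ S] exI[of _ "{}"]) (auto simp: even_on_def)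
  next
    case False
    then obtain v where v: "v \<in> S" and odd: "odd (card {w \<in> S. E v w})"
      by (auto simp: even_on_def)
    have "irreflp (local_complement E v)" "symp (local_complement E v)"
      using \<open>symp E\<close> by (auto simp: irreflp_def symp_def local_complement_def)
    moreover have "S - {v} \<subset> S" using v by blast
    ultimately obtain A B where AB: "A \<union> B = S - {v}" "A \<inter> B = {}"
        "even_on (local_complement E v) A" "even_on (local_complement E v) B"
      using psubset.IH[of "S - {v}" "local_complement E v"] by metis
    have fin: "finite A" "finite B"
      using finite_subset[of A "S - {v}"] finite_subset[of B "S - {v}"] AB(1) \<open>finite S\<close> by auto
    have "{w \<in> S. E v w} = {w \<in> A. E v w} \<union> {w \<in> B. E v w}"
      using AB(1) \<open>irreflp E\<close> by (auto simp: irreflp_def)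
    then have "card {w \<in> S. E v w} = card {w \<in> A. E v w} + card {w \<in> B. E v w}"
      using fin AB(2) card_Un_disjoint[of "{w \<in> A. E v w}" "{w \<in> B. E v w}"] by auto
    \<comment> \<open>Exactly one part contains an odd number of neighbours of \<open>v\<close>.
      That part is already even for \<open>E\<close>, and \<open>v\<close> joins the other
      one.\<close>
    with odd have parity: "odd (card {w \<in> A. E v w}) \<longleftrightarrow> even (card {w \<in> B. E v w})" by simp
    have v': "v \<notin> A" "v \<notin> B" using AB(1) by blast+
    show ?thesis
    proof (cases "odd (card {w \<in> A. E v w})")
      case True
      have "even_on E A" "even_on E (insert v B)"
        using True parity fin v' AB psubset.prems
        by (auto intro: even_on_if_odd_neighbours even_on_insert_if_even_neighbours)
      moreover have "A \<union> insert v B = S" "A \<inter> insert v B = {}" using AB v v' by auto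
      ultimately show ?thesis by blast
    next
      case False
      have "even_on E (insert v A)" "even_on E B"
        using False parity fin v' AB psubset.prems
        by (auto intro: even_on_if_odd_neighbours even_on_insert_if_even_neighbours)
      moreover have "insert v A \<union> B = S" "insert v A \<inter> B = {}" using AB v v' by auto
      ultimately show ?thesis by blast
    qed
  qed
qed

section \<open>Even subsets of prescribed size\<close>

text \<open>If deleting \<open>y\<close> leaves \<open>u\<close> with even degree, then the degree
  of \<open>u\<close> in \<open>S\<close> is odd exactly when \<open>u\<close> is adjacent to
  \<open>y\<close>. Comparing \<open>y = v\<close> with \<open>y = w\<close> gives the
  claim.\<close>

lemma even_on_delete_imp_twins:
  assumes "finite S" "even_on E (S - {v})" "even_on E (S - {w})"
    and "u \<in> S" "v \<in> S" "w \<in> S" "u \<noteq> v" "u \<noteq> w"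
  shows "E u v \<longleftrightarrow> E u w"
proof -
  have *: "odd (card {x \<in> S. E u x}) \<longleftrightarrow> E u y"
    if "even_on E (S - {y})" "y \<in> S" "u \<noteq> y" for y
  proof -
    have ev: "even (card {x \<in> S - {y}. E u x})"
      using that \<open>u \<in> S\<close> by (simp add: even_on_def)
    have "{x \<in> S. E u x} =
        (if E u y then insert y {x \<in> S - {y}. E u x} else {x \<in> S - {y}. E u x})"
      using \<open>y \<in> S\<close> by auto
    then show ?thesis using ev \<open>finite S\<close> by (simp split: if_splits)
  qed
  show ?thesis using *[of v] *[of w] assms by simp
qed

lemma even_subset_exists:
  assumes "finite S" "irreflp E" "symp E" and card: "card S = 2 * j" and "j \<ge> 3"
  shows "\<exists>T\<subseteq>S. even_on E T \<and> j \<le> card T \<and> card T \<le> 2 * j - 2"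
proof (cases "\<forall>v\<in>S. even_on E (S - {v})")
  case False
  then obtain v where v: "v \<in> S" "\<not> even_on E (S - {v})" by blast
  obtain A B where AB: "A \<union> B = S - {v}" "A \<inter> B = {}" "even_on E A" "even_on E B"
    using even_partition[of "S - {v}" E] assms by auto
  have fin: "finite A" "finite B"
    using finite_subset[of A "S - {v}"] finite_subset[of B "S - {v}"] AB(1) \<open>finite S\<close> by auto
  have sum: "card A + card B = 2 * j - 1"
    using card_Un_disjoint[OF fin AB(2)] AB(1) v card \<open>finite S\<close> by simp
  \<comment> \<open>An empty part would make the other one all of \<open>S - {v}\<close>, which is
    not even. Two nonempty parts of total size \<open>2 * j - 1\<close> force the larger one into
    the required range.\<close>
  have "A \<noteq> {}" "B \<noteq> {}" using AB v by auto
  then have pos: "card A > 0" "card B > 0" using fin by (auto simp: card_gt_0_iff)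
  have sub: "A \<subseteq> S" "B \<subseteq> S" using AB(1) by auto
  show ?thesis
  proof (cases "j \<le> card A")
    case True
    moreover have "card A \<le> 2 * j - 2" using sum pos by linarith
    ultimately show ?thesis using AB sub by blast
  next
    case False
    then have "j \<le> card B" "card B \<le> 2 * j - 2" using sum pos by linarith+
    then show ?thesis using AB sub by blast
  qed
next
  case True
  \<comment> \<open>By the twin property each vertex of \<open>T\<close> has no neighbour in
    \<open>T\<close> or is adjacent to all the others, so an odd order makes every degree even. The
    order \<open>2 * j - 3\<close> is at least \<open>j\<close> because
    \<open>j \<ge> 3\<close>.\<close>
  obtain T where T: "T \<subseteq> S" "card T = 2 * j - 3"
    using obtain_subset_with_card_n[of "2 * j - 3" S] card by auto
  have finT: "finite T" using T \<open>finite S\<close> finite_subset by blast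
  have "even (card {w \<in> T. E u w})" if "u \<in> T" for u
  proof (cases "\<exists>w\<in>T. E u w")
    case False
    then have "{w \<in> T. E u w} = {}" by blast
    then show ?thesis by (simp only: card.empty even_zero)
  next
    case ex: True
    then obtain w where w: "w \<in> T" "E u w" by blast
    then have "u \<noteq> w" using \<open>irreflp E\<close> by (auto simp: irreflp_def)
    then have "E u x" if "x \<in> T" "x \<noteq> u" for x
      using even_on_delete_imp_twins[of S E x w u] True T(1) w that \<open>u \<in> T\<close> \<open>finite S\<close> by blast
    then have "{w \<in> T. E u w} = T - {u}" using \<open>irreflp E\<close> by (auto simp: irreflp_def)
    then have "card {w \<in> T. E u w} = 2 * (j - 2)"
      using T \<open>u \<in> T\<close> finT by simp
    then show ?thesis by simp
  qed
  then have "even_on E T" by (simp add: even_on_def)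
  moreover have "j \<le> card T" "card T \<le> 2 * j - 2" using T \<open>j \<ge> 3\<close> by linarith+
  ultimately show ?thesis using T by blast
qed

section \<open>Double counting\<close>

text \<open>Shrinking \<open>T\<close> to a subset \<open>T'\<close> of size exactly
  \<open>i\<close> gives a bound uniform in \<open>T\<close>: each \<open>S\<close> is determined by
  the \<open>k\<close>-set \<open>S - T'\<close>.\<close>

lemma card_supersets_le:
  assumes "finite V" "T \<subseteq> V" "i \<le> card T"
  shows "card {S. T \<subseteq> S \<and> S \<subseteq> V \<and> card S = i + k} \<le> (card V - i) choose k"
proof -
  obtain T' where T': "T' \<subseteq> T" "card T' = i" "finite T'"
    using obtain_subset_with_card_n[OF assms(3)] by blast
  let ?F = "{S. T \<subseteq> S \<and> S \<subseteq> V \<and> card S = i + k}"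
  have "card ?F \<le> card {U. U \<subseteq> V - T' \<and> card U = k}"
  proof (rule card_inj_on_le)
    show "inj_on (\<lambda>S. S - T') ?F"
      using T' by (intro inj_onI) blast
    show "(\<lambda>S. S - T') ` ?F \<subseteq> {U. U \<subseteq> V - T' \<and> card U = k}"
    proof clarsimp
      fix S assume S: "T \<subseteq> S" "S \<subseteq> V" "card S = i + k"
      then have "card (S - T') = card S - card T'"
        using T' by (intro card_Diff_subset) auto
      then show "S - T' \<subseteq> V - T' \<and> card (S - T') = k" using S T' by auto
    qed
    show "finite {U. U \<subseteq> V - T' \<and> card U = k}" using \<open>finite V\<close> by simp
  qed
  also have "\<dots> = card (V - T') choose k"
    using \<open>finite V\<close> by (intro n_subsets) simp
  also have "card (V - T') = card V - i"
    using T' assms by (simp add: card_Diff_subset subset_trans)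
  finally show ?thesis .
qed

lemma choose_le_card_family:
  assumes "finite V" and F: "F \<subseteq> Pow V" "\<And>T. T \<in> F \<Longrightarrow> j \<le> card T"
    and cover: "\<And>S. S \<subseteq> V \<Longrightarrow> card S = 2 * j \<Longrightarrow> \<exists>T\<in>F. T \<subseteq> S"
    and j: "2 * j \<le> card V"
  shows "card V choose j \<le> card F * 4 ^ j"
proof -
  let ?n = "card V"
  let ?up = "\<lambda>T. {S. T \<subseteq> S \<and> S \<subseteq> V \<and> card S = j + j}"
  have finF: "finite F" using F(1) \<open>finite V\<close> by (meson finite_Pow_iff finite_subset)
  have "?n choose (2 * j) = card {S. S \<subseteq> V \<and> card S = 2 * j}"
    using n_subsets[OF \<open>finite V\<close>] by simp
  also have "\<dots> \<le> card (\<Union>T\<in>F. ?up T)"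
  proof (rule card_mono)
    show "finite (\<Union>T\<in>F. ?up T)"
      by (rule finite_subset[of _ "Pow V"]) (use \<open>finite V\<close> in auto)
    show "{S. S \<subseteq> V \<and> card S = 2 * j} \<subseteq> (\<Union>T\<in>F. ?up T)"
      using cover by (fastforce simp: mult_2)
  qed
  also have "\<dots> \<le> (\<Sum>T\<in>F. card (?up T))" by (rule card_UN_le[OF finF])
  also have "\<dots> \<le> (\<Sum>T\<in>F. (?n - j) choose j)"
    using F \<open>finite V\<close> by (intro sum_mono card_supersets_le) auto
  finally have *: "?n choose (2 * j) \<le> card F * ((?n - j) choose j)" by simp
  \<comment> \<open>Multiplying by \<open>(2 * j) choose j \<le> 4 ^ j\<close> produces the factor
    \<open>(?n - j) choose j\<close> on both sides. It is positive since
    \<open>2 * j \<le> ?n\<close>, and cancels at the end.\<close>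
  have "(?n choose j) * ((?n - j) choose j) = (?n choose (2 * j)) * ((2 * j) choose j)"
    using choose_mult[of j "2 * j" ?n] j by simp
  also have "\<dots> \<le> (card F * ((?n - j) choose j)) * 2 ^ (2 * j)"
    by (intro mult_mono * binomial_le_pow2) auto
  also have "\<dots> = (card F * 4 ^ j) * ((?n - j) choose j)"
    by (simp add: power_mult)
  finally show ?thesis using j by simp
qed

section \<open>Entropy bound for binomial coefficients\<close>

lemma ln_fact_ge: "real m * ln (real m) - real m \<le> ln (fact m)"
proof (cases "m = 0")
  case False
  \<comment> \<open>The left side is a single term of the exponential series at
    \<open>m\<close>.\<close>
  have "real m ^ m / fact m \<le> exp (real m)"
    using sum_le_suminf[OF summable_exp_generic[of "real m"], of "{m}"]
    by (simp add: exp_def divide_inverse mult.commute)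
  then have "ln (real m ^ m / fact m) \<le> real m"
    using False by (metis ln_exp ln_le_cancel_iff exp_gt_zero divide_pos_pos fact_gt_zero
        zero_less_power of_nat_0_less_iff gr0I)
  then show ?thesis using False by (simp add: ln_div ln_realpow)
qed simp

text \<open>The induction step reduces to \<open>1 \<le> (m + 1) * (ln (m + 1) - ln m)\<close>,
  which is \<open>ln x \<le> x - 1\<close> at \<open>x = m / (m + 1)\<close>.\<close>

lemma ln_fact_le:
  assumes "m > 0"
  shows "ln (fact m) \<le> (real m + 1) * ln (real m) - real m + 1"
  using assms
proof (induction m rule: nat_induct_non_zero)
  case (Suc m)
  have "1 - real m / (real m + 1) \<le> - ln (real m / (real m + 1))"
    using ln_le_minus_one[of "real m / (real m + 1)"] Suc by simp
  then have "1 / (real m + 1) \<le> ln (real m + 1) - ln (real m)"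
    using Suc by (simp add: ln_div field_simps)
  then have "1 \<le> (real m + 1) * (ln (real m + 1) - ln (real m))"
    by (simp add: field_simps)
  moreover have "ln (fact (Suc m)) = ln (real m + 1) + ln (fact m)"
    using ln_mult[of "real m + 1" "fact m"] by (simp add: add.commute)
  ultimately show ?case using Suc.IH by (simp add: algebra_simps)
qed simp

text \<open>The right side collects the main terms \<open>m * ln m\<close> of the three factorials
  in \<open>n choose j\<close>.\<close>

lemma binary_entropy_ratio:
  assumes "0 < j" "j < n"
  shows "real n * binary_entropy (real j / real n) * ln 2 =
    real n * ln (real n) - real j * ln (real j) - real (n - j) * ln (real (n - j))"
proof -
  have "1 - real j / real n = real (n - j) / real n"
    using assms by (simp add: field_simps of_nat_diff)
  then have "binary_entropy (real j / real n) * ln 2 =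
    - (real j / real n) * (ln (real j) - ln (real n)) -
    (real (n - j) / real n) * (ln (real (n - j)) - ln (real n))"
    using assms by (simp add: binary_entropy_def log_def ln_div field_simps)
  then have "real n * (binary_entropy (real j / real n) * ln 2) =
    - real j * (ln (real j) - ln (real n)) - real (n - j) * (ln (real (n - j)) - ln (real n))"
    using assms by (simp add: right_diff_distrib del: of_nat_diff)
  then show ?thesis using assms by (simp add: of_nat_diff algebra_simps)
qed

text \<open>In the factorial bounds the linear terms cancel. What is lost is
  \<open>ln j + ln (n - j) + 2\<close>, at most \<open>2 * ln n + 2\<close>.\<close>

lemma log_choose_ge_entropy:
  assumes "0 < j" "j < n"
  shows "log 2 (real (n choose j)) \<ge>
    real n * binary_entropy (real j / real n) - (2 * ln (real n) + 2) / ln 2"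
proof -
  have "ln (real (n choose j)) = ln (fact n) - ln (fact j) - ln (fact (n - j))"
    using assms by (simp add: binomial_fact ln_div ln_mult)
  moreover have "ln (real j) \<le> ln (real n)" "ln (real (n - j)) \<le> ln (real n)"
    using assms by simp_all
  moreover have "real (n - j) = real n - real j" using assms by simp
  ultimately have "ln (real (n choose j)) \<ge>
      real n * binary_entropy (real j / real n) * ln 2 - (2 * ln (real n) + 2)"
    using ln_fact_ge[of n] ln_fact_le[of j, unfolded distrib_right]
      ln_fact_le[of "n - j", unfolded distrib_right] binary_entropy_ratio[OF assms] assms
    by linarith
  then have "ln (real (n choose j)) / ln 2 \<ge>
      (real n * binary_entropy (real j / real n) * ln 2 - (2 * ln (real n) + 2)) / ln 2"
    by (intro divide_right_mono) auto
  then show ?thesis by (simp add: log_def diff_divide_distrib)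
qed

text \<open>At \<open>x = \<alpha> / 2\<close> this makes the exponent
  \<open>H(\<alpha>/2) - \<alpha>\<close> positive, so that it can be divided by. The function
  \<open>g y\<close> is \<open>binary_entropy y * ln 2 / y\<close>, which decreases strictly to
  \<open>2 * ln 2\<close> at \<open>1 / 2\<close>.\<close>

lemma binary_entropy_gt:
  assumes "0 < x" "x < 1 / 2"
  shows "binary_entropy x > 2 * x"
proof -
  define g where "g y = - ln y - (1 - y) / y * ln (1 - y)" for y :: real
  have "g (1 / 2) < g x"
  proof (rule DERIV_neg_imp_decreasing[OF assms(2)])
    fix y :: real assume y: "x \<le> y" "y \<le> 1 / 2"
    have "(g has_real_derivative ln (1 - y) / y\<^sup>2) (at y)"
      unfolding g_def using y assms
      by (auto intro!: derivative_eq_intros simp: field_simps power2_eq_square)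
    moreover have "ln (1 - y) / y\<^sup>2 < 0"
      using y assms by (intro divide_neg_pos) auto
    ultimately show "\<exists>d. (g has_real_derivative d) (at y) \<and> d < 0" by blast
  qed
  moreover have "g (1 / 2) = 2 * ln 2" by (simp add: g_def ln_div)
  moreover have "binary_entropy x = x * g x / ln 2"
    using assms by (simp add: binary_entropy_def g_def log_def field_simps)
  ultimately show ?thesis using assms by (simp add: pos_less_divide_eq)
qed

lemma isCont_binary_entropy:
  assumes "0 < x" "x < 1"
  shows "isCont binary_entropy x"
  unfolding binary_entropy_def log_def using assms by (intro continuous_intros) auto

section \<open>Even induced subgraphs\<close>

text \<open>Without parallel arcs, \<open>head G\<close> is injective on the arcs leaving
  \<open>v\<close>, so counting arcs becomes counting neighbours.\<close>

lemma (in graph) out_degree_induce_subgraph: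
  assumes "v \<in> S"
  shows "out_degree (G \<restriction> S) v = card {w \<in> S. v \<rightarrow>\<^bsub>G\<^esub> w}"
proof -
  have "bij_betw (head G) (out_arcs (G \<restriction> S) v) {w \<in> S. v \<rightarrow>\<^bsub>G\<^esub> w}"
    unfolding bij_betw_def
  proof
    show "inj_on (head G) (out_arcs (G \<restriction> S) v)"
      by (auto intro!: inj_onI no_multi_arcs simp: arc_to_ends_def)
    show "head G ` out_arcs (G \<restriction> S) v = {w \<in> S. v \<rightarrow>\<^bsub>G\<^esub> w}"
      using \<open>v \<in> S\<close> by (force simp: arcs_ends_def arc_to_ends_def)
  qed
  then show ?thesis unfolding out_degree_def by (rule bij_betw_same_card)
qed

lemma (in graph) even_graph_induce_subgraph_iff:
  "even_graph (G \<restriction> S) \<longleftrightarrow> even_on (\<lambda>u v. u \<rightarrow>\<^bsub>G\<^esub> v) S"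
  by (auto simp: even_graph_def even_on_def out_degree_induce_subgraph)

lemma (in graph) choose_le_card_even_induced:
  assumes "card (verts G) = n" "j \<ge> 3" "2 * j \<le> n" "a \<le> real j" "real (2 * j - 2) \<le> b"
  shows "n choose j \<le> card (even_induced_in_range G a b) * 4 ^ j"
proof -
  let ?E = "\<lambda>u v. u \<rightarrow>\<^bsub>G\<^esub> v"
  let ?F = "{S. S \<subseteq> verts G \<and> even_on ?E S \<and> j \<le> card S \<and> card S \<le> 2 * j - 2}"
  have E: "irreflp ?E" "symp ?E"
    using adj_not_same graph_symmetric by (auto simp: irreflp_def symp_def)
  have "n choose j \<le> card ?F * 4 ^ j"
    unfolding assms(1)[symmetric]
  proof (rule choose_le_card_family)
    fix S assume S: "S \<subseteq> verts G" "card S = 2 * j"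
    then have "finite S" using finite_subset finite_verts by blast
    then obtain T where "T \<subseteq> S" "even_on ?E T" "j \<le> card T" "card T \<le> 2 * j - 2"
      using even_subset_exists[OF _ E S(2) \<open>j \<ge> 3\<close>] by metis
    then show "\<exists>T\<in>?F. T \<subseteq> S" using \<open>S \<subseteq> verts G\<close> by blast
  qed (use assms in auto)
  also have "card ?F \<le> card (even_induced_in_range G a b)"
  proof (rule card_mono)
    show "finite (even_induced_in_range G a b)"
      by (rule finite_subset[of _ "Pow (verts G)"]) (auto simp: even_induced_in_range_def)
    have "a \<le> real (card S)" "real (card S) \<le> b" if "j \<le> card S" "card S \<le> 2 * j - 2" for S :: "'a set"
      using that assms by (meson of_nat_mono order_trans)+
    then show "?F \<subseteq> even_induced_in_range G a b"
      by (auto simp: even_induced_in_range_def even_graph_induce_subgraph_iff)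
  qed
  finally show ?thesis by simp
qed

theorem theorem1p2:
  fixes \<alpha> :: real
  assumes "0 < \<alpha>" and "\<alpha> < 1"
  shows "\<exists>\<epsilon> :: nat \<Rightarrow> real. \<epsilon> \<longlonglongrightarrow> 0 \<and>
    (\<forall>\<^sub>F n in sequentially. \<forall>G :: ('a, 'b) pre_digraph. graph G \<and> card (verts G) = n \<longrightarrow>
      real (card (even_induced_in_range G (\<alpha> * real n / 2) (\<alpha> * real n)))
        \<ge> 2 powr ((1 + \<epsilon> n) * (binary_entropy (\<alpha> / 2) - \<alpha>) * real n))"
proof -
  \<comment> \<open>The least integer above \<open>\<alpha> * n / 2\<close>: then \<open>j n\<close>
    reaches the lower end of the interval, while \<open>2 * j n - 2\<close> is twice the floor and
    stays below the upper end.\<close>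
  define j where "j n = nat \<lfloor>\<alpha> * real n / 2\<rfloor> + 1" for n :: nat
  define c where "c = binary_entropy (\<alpha> / 2) - \<alpha>"
  \<comment> \<open>The lower bound obtained for the logarithm of the count, divided by
    \<open>n\<close>. The factor \<open>4 ^ j n\<close> costs
    \<open>2 * j n \<le> \<alpha> * n + 2\<close>, whence the terms \<open>2 / n\<close> and
    \<open>\<alpha>\<close>.\<close>
  define r where "r n = binary_entropy (real (j n) / real n) -
    (2 * ln (real n) + 2) / (ln 2 * real n) - 2 / real n - \<alpha>" for n :: nat
  have c: "c > 0" using binary_entropy_gt[of "\<alpha> / 2"] assms by (simp add: c_def)
  have j_bounds: "\<alpha> * real n / 2 \<le> real (j n)" "2 * real (j n) - 2 \<le> \<alpha> * real n" for n
  proof -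
    have "real (j n) = of_int \<lfloor>\<alpha> * real n / 2\<rfloor> + 1"
      using assms by (simp add: j_def)
    then show "\<alpha> * real n / 2 \<le> real (j n)" "2 * real (j n) - 2 \<le> \<alpha> * real n"
      by linarith+
  qed
  have "(\<lambda>n. real (j n) / real n) \<longlonglongrightarrow> \<alpha> / 2"
  proof (rule tendsto_sandwich)
    show "\<forall>\<^sub>F n in sequentially. (\<alpha> * real n / 2) / real n \<le> real (j n) / real n"
      using j_bounds by (intro always_eventually allI divide_right_mono) auto
    show "\<forall>\<^sub>F n in sequentially. real (j n) / real n \<le> (\<alpha> * real n / 2 + 1) / real n"
      using j_bounds(2) by (intro always_eventually allI divide_right_mono) (auto simp: field_simps)
    show "(\<lambda>n. (\<alpha> * real n / 2) / real n) \<longlonglongrightarrow> \<alpha> / 2"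
      "(\<lambda>n. (\<alpha> * real n / 2 + 1) / real n) \<longlonglongrightarrow> \<alpha> / 2"
      by real_asymp+
  qed
  then have "(\<lambda>n. binary_entropy (real (j n) / real n)) \<longlonglongrightarrow> binary_entropy (\<alpha> / 2)"
    using assms by (intro isCont_tendsto_compose[OF isCont_binary_entropy]) auto
  moreover have "(\<lambda>n. (2 * ln (real n) + 2) / (ln 2 * real n)) \<longlonglongrightarrow> 0"
    "(\<lambda>n. 2 / real n) \<longlonglongrightarrow> 0"
    by real_asymp+
  ultimately have "r \<longlonglongrightarrow> binary_entropy (\<alpha> / 2) - 0 - 0 - \<alpha>"
    unfolding r_def by (intro tendsto_intros)
  \<comment> \<open>The witness for the error term is \<open>r n / c - 1\<close>, chosen so that
    \<open>(1 + (r n / c - 1)) * c = r n\<close>.\<close>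
  then have "(\<lambda>n. r n / c - 1) \<longlonglongrightarrow> c / c - 1"
    using c by (intro tendsto_intros) (auto simp: c_def)
  then have lim: "(\<lambda>n. r n / c - 1) \<longlonglongrightarrow> 0" using c by simp
  \<comment> \<open>These bounds give \<open>j n \<ge> 3\<close> and \<open>2 * j n \<le> n\<close>.
    The second one is available because \<open>\<alpha> < 1\<close>.\<close>
  have "\<forall>\<^sub>F n in sequentially. \<alpha> * real n / 2 \<ge> 3" "\<forall>\<^sub>F n in sequentially. \<alpha> * real n + 2 \<le> real n"
    using assms by real_asymp+
  then have "\<forall>\<^sub>F n in sequentially. \<forall>G :: ('a, 'b) pre_digraph. graph G \<and> card (verts G) = n \<longrightarrow>
      real (card (even_induced_in_range G (\<alpha> * real n / 2) (\<alpha> * real n)))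
        \<ge> 2 powr ((1 + (r n / c - 1)) * c * real n)"
  proof eventually_elim
    case (elim n)
    have j: "j n \<ge> 3" "2 * j n \<le> n" "0 < j n" "j n < n"
      using elim j_bounds[of n] by linarith+
    show ?case
    proof (intro allI impI, elim conjE)
      fix G :: "('a, 'b) pre_digraph"
      assume "graph G" and n: "card (verts G) = n"
      let ?N = "card (even_induced_in_range G (\<alpha> * real n / 2) (\<alpha> * real n))"
      have le: "n choose j n \<le> ?N * 4 ^ j n"
        using j j_bounds[of n] \<open>graph G\<close> n by (intro graph.choose_le_card_even_induced) auto
      have pos: "0 < n choose j n" using j by simp
      \<comment> \<open>Positivity of the count is needed before taking logarithms.\<close>
      then have N: "0 < ?N" using le by (cases ?N) auto
      have "real (n choose j n) \<le> real ?N * 4 ^ j n"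
        using le by (metis of_nat_le_iff of_nat_mult of_nat_power of_nat_numeral)
      then have "log 2 (real (n choose j n)) \<le> log 2 (real ?N * 2 ^ (2 * j n))"
        using pos N by (simp add: power_mult)
      also have "\<dots> = log 2 (real ?N) + 2 * real (j n)"
        using N by (subst log_mult) (auto simp: log_nat_power)
      finally have "log 2 (real (n choose j n)) \<le> log 2 (real ?N) + 2 * real (j n)" .
      moreover have "r n * real n = real n * binary_entropy (real (j n) / real n) -
          (2 * ln (real n) + 2) / ln 2 - 2 - \<alpha> * real n"
        using j by (simp add: r_def field_simps)
      ultimately have "r n * real n \<le> log 2 (real ?N)"
        using log_choose_ge_entropy[OF j(3,4)] j_bounds(2)[of n] by linarith
      then have "2 powr (r n * real n) \<le> real ?N"
        using N by (simp add: le_log_iff)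
      then show "real ?N \<ge> 2 powr ((1 + (r n / c - 1)) * c * real n)" using c by simp
    qed
  qed
  with lim show ?thesis unfolding c_def by blast
qed

end
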